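(* Let $G$ be a Hausdorff topological group. For a subset $K\subset G$ let $\langle K\rangle$ be the subgroup of $G$ generated by $K$ and let $\overline{\langle K\rangle}$ be its closure in $G$ (a topological group with the subspace topology). Then \[ \operatorname{asdim}(G)=\sup\left\{\operatorname{asdim}\left(\overline{\langle K\rangle}\right) : K\subset G \text{ compact}\right\}. \]
   Context: Coarse structure: a coarse structure on a set $Y$ is a collection $\mathcal{E}$ of subsets of $Y\times Y$ (entourages) that contains the diagonal and is closed under subsets, finite unions, inverses $E^{-1}=\{(y,x) : (x,y)\in E\}$ and compositions $E_1\circ E_2=\{(x,z) : \exists y,\ (x,y)\in E_1,\ (y,z)\in E_2\}$. Group-compact coarse structure: for a Hausdorff topological group $G$, it is $\mathcal{E}_{\mathcal{C}(G)}=\{E\subset G\times G : E\subset G(K\times K) \text{ for some compact } K\subset G\}$, where $G(K\times K)=\{(ga,gb) : g\in G,\ a,b\in K\}$. Asymptotic dimension: for a coarse space $(Y,\mathcal{E})$ and an integer $n\ge 0$, $\operatorname{asdim}(Y,\mathcal{E})\le n$ means that for every $L\in\mathcal{E}$ there is a cover $\mathcal{U}=\mathcal{U}_0\cup\dots\cup\mathcal{U}_n$ of $Y$ such that each $\mathcal{U}_i$ is $L$-disjoint (for all $A\ne B$ in $\mathcal{U}_i$, $(A\times B)\cap L=\emptyset$) and $\mathcal{U}$ is uniformly bounded (there is $M\in\mathcal{E}$ with $A\times A\subset M$ for all $A\in\mathcal{U}$). $\operatorname{asdim}(Y,\mathcal{E})$ is the least such $n$, or $\infty$ if there is none. For a Hausdorff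 topological group $G$, $\operatorname{asdim}(G):=\operatorname{asdim}(G,\mathcal{E}_{\mathcal{C}(G)})$. The supremum is taken in $\{0,1,2,\dots\}\cup\{\infty\}$. *)

theory Defs
  imports "HOL-Analysis.Analysis" "HOL-Algebra.Generated_Groups" "HOL-Library.Extended_Nat"
begin

(* HOL-Algebra uses the same token, which makes the topological closure ambiguous. *)
no_notation eq_closure_of ("closure'_of\<index>")

definition coarse_structure :: "'a set \<Rightarrow> ('a \<times> 'a) set set \<Rightarrow> bool" where
  "coarse_structure Y \<E> \<longleftrightarrow>
     \<E> \<subseteq> Pow (Y \<times> Y) \<and>
     Id_on Y \<in> \<E> \<and>
     (\<forall>E\<in>\<E>. \<forall>F. F \<subseteq> E \<longrightarrow> F \<in> \<E>) \<and>
     (\<forall>E\<in>\<E>. \<forall>F\<in>\<E>. E \<union> F \<in> \<E>) \<and>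
     (\<forall>E\<in>\<E>. E\<inverse> \<in> \<E>) \<and>
     (\<forall>E\<in>\<E>. \<forall>F\<in>\<E>. E O F \<in> \<E>)"

definition entourage_disjoint :: "('a \<times> 'a) set \<Rightarrow> 'a set set \<Rightarrow> bool" where
  "entourage_disjoint L \<U> \<longleftrightarrow> (\<forall>A\<in>\<U>. \<forall>B\<in>\<U>. A \<noteq> B \<longrightarrow> (A \<times> B) \<inter> L = {})"

definition uniformly_bounded :: "('a \<times> 'a) set set \<Rightarrow> 'a set set \<Rightarrow> bool" where
  "uniformly_bounded \<E> \<U> \<longleftrightarrow> (\<exists>M\<in>\<E>. \<forall>A\<in>\<U>. A \<times> A \<subseteq> M)"

definition asdim_le :: "'a set \<Rightarrow> ('a \<times> 'a) set set \<Rightarrow> nat \<Rightarrow> bool" where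
  "asdim_le Y \<E> n \<longleftrightarrow>
     (\<forall>L\<in>\<E>. \<exists>\<U> :: nat \<Rightarrow> 'a set set.
        \<Union> (\<Union>i\<le>n. \<U> i) = Y \<and>
        (\<forall>i\<le>n. entourage_disjoint L (\<U> i)) \<and>
        uniformly_bounded \<E> (\<Union>i\<le>n. \<U> i))"

text \<open>In \<^typ>\<open>enat\<close> the infimum of a nonempty set is its least element, and
  \<^prop>\<open>Inf ({} :: enat set) = \<infinity>\<close>.\<close>

definition asdim :: "'a set \<Rightarrow> ('a \<times> 'a) set set \<Rightarrow> enat" where
  "asdim Y \<E> = Inf {enat n | n. asdim_le Y \<E> n}"

lemma asdim_le_mono:
  assumes "asdim_le Y \<E> m" and "m \<le> n"
  shows "asdim_le Y \<E> n"
  unfolding asdim_le_def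
proof
  fix L assume "L \<in> \<E>"
  then obtain \<U> :: "nat \<Rightarrow> 'a set set" where U: "\<Union> (\<Union>i\<le>m. \<U> i) = Y"
      "\<forall>i\<le>m. entourage_disjoint L (\<U> i)" "uniformly_bounded \<E> (\<Union>i\<le>m. \<U> i)"
    using assms(1) unfolding asdim_le_def by blast
  define \<V> where "\<V> = (\<lambda>i. if i \<le> m then \<U> i else {})"
  have eq: "(\<Union>i\<le>n. \<V> i) = (\<Union>i\<le>m. \<U> i)"
  proof (intro subset_antisym subsetI)
    fix A assume "A \<in> (\<Union>i\<le>n. \<V> i)"
    then obtain i where "A \<in> \<V> i" by blast
    then show "A \<in> (\<Union>i\<le>m. \<U> i)" by (cases "i \<le> m") (auto simp: \<V>_def)
  next
    fix A assume "A \<in> (\<Union>i\<le>m. \<U> i)"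
    then obtain i where "i \<le> m" "A \<in> \<U> i" by blast
    then have "i \<le> n" "A \<in> \<V> i" using assms(2) by (auto simp: \<V>_def)
    then show "A \<in> (\<Union>i\<le>n. \<V> i)" by blast
  qed
  have "\<forall>i\<le>n. entourage_disjoint L (\<V> i)"
    using U(2) by (simp add: \<V>_def entourage_disjoint_def)
  with U eq show "\<exists>\<U>. \<Union> (\<Union>i\<le>n. \<U> i) = Y \<and> (\<forall>i\<le>n. entourage_disjoint L (\<U> i)) \<and>
      uniformly_bounded \<E> (\<Union>i\<le>n. \<U> i)"
    by (intro exI[of _ \<V>]) simp
qed

lemma asdim_le_enat_iff: "asdim Y \<E> \<le> enat n \<longleftrightarrow> asdim_le Y \<E> n"
proof
  assume le: "asdim Y \<E> \<le> enat n"
  let ?S = "{enat n | n. asdim_le Y \<E> n}"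
  have "?S \<noteq> {}"
  proof
    assume "?S = {}"
    then have "asdim Y \<E> = \<infinity>"
      by (simp only: asdim_def Inf_enat_def if_True simp_thms)
    with le show False by simp
  qed
  then obtain k where "k \<in> ?S" by blast
  then have "(LEAST x. x \<in> ?S) \<in> ?S" by (rule LeastI)
  then have "Inf ?S \<in> ?S"
    using \<open>?S \<noteq> {}\<close> by (simp only: Inf_enat_def if_False)
  then obtain m where "asdim Y \<E> = enat m" "asdim_le Y \<E> m"
    unfolding asdim_def by auto
  with le show "asdim_le Y \<E> n"
    using asdim_le_mono[of Y \<E> m n] by simp
next
  assume "asdim_le Y \<E> n"
  then show "asdim Y \<E> \<le> enat n"
    unfolding asdim_def by (auto intro: Inf_lower)
qed

locale hausdorff_topological_group = group G for G (structure) +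
  fixes T :: "'a topology"
  assumes topspace_eq: "topspace T = carrier G"
    and Hausdorff: "Hausdorff_space T"
    and continuous_mult: "continuous_map (prod_topology T T) T (\<lambda>(x, y). x \<otimes> y)"
    and continuous_inv: "continuous_map T T (\<lambda>x. inv x)"

definition group_compact_coarse :: "('a, 'b) monoid_scheme \<Rightarrow> 'a topology \<Rightarrow> ('a \<times> 'a) set set" where
  "group_compact_coarse G T =
     {E. \<exists>K. compactin T K \<and>
          E \<subseteq> {(g \<otimes>\<^bsub>G\<^esub> a, g \<otimes>\<^bsub>G\<^esub> b) | g a b. g \<in> carrier G \<and> a \<in> K \<and> b \<in> K}}"

definition asdim_group :: "('a, 'b) monoid_scheme \<Rightarrow> 'a topology \<Rightarrow> enat" where
  "asdim_group G T = asdim (carrier G) (group_compact_coarse G T)"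

context hausdorff_topological_group
begin

lemma compactin_carrier: "compactin T K \<Longrightarrow> K \<subseteq> carrier G"
  using compactin_subset_topspace topspace_eq by fastforce

lemma compactin_mult:
  assumes "compactin T K" "compactin T L"
  shows "compactin T ((\<lambda>(x, y). x \<otimes> y) ` (K \<times> L))"
  using assms by (intro image_compactin[OF _ continuous_mult]) (simp add: compactin_Times)

lemma compactin_m_inv: "compactin T K \<Longrightarrow> compactin T ((\<lambda>x. inv x) ` K)"
  using image_compactin continuous_inv by blast

lemma coarse_structure_group_compact: "coarse_structure (carrier G) (group_compact_coarse G T)"
proof -
  let ?O = "\<lambda>K. {(g \<otimes> a, g \<otimes> b) | g a b. g \<in> carrier G \<and> a \<in> K \<and> b \<in> K}"
  let ?E = "group_compact_coarse G T"
  have memI: "E \<in> ?E" if "compactin T K" "E \<subseteq> ?O K" for E K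
    using that unfolding group_compact_coarse_def by blast
  have memE: "\<exists>K. compactin T K \<and> E \<subseteq> ?O K" if "E \<in> ?E" for E
    using that unfolding group_compact_coarse_def by blast
  have sub: "E \<subseteq> carrier G \<times> carrier G" if "E \<in> ?E" for E
  proof -
    obtain K where "compactin T K" "E \<subseteq> ?O K"
      using memE[OF \<open>E \<in> ?E\<close>] by blast
    with compactin_carrier[of K] show ?thesis
      by fastforce
  qed
  have diag: "Id_on (carrier G) \<in> ?E"
  proof (rule memI)
    show "compactin T {\<one>}"
      by (simp add: topspace_eq)
    show "Id_on (carrier G) \<subseteq> ?O {\<one>}"
      by force
  qed
  have down: "F \<in> ?E" if "E \<in> ?E" "F \<subseteq> E" for E F
    using that unfolding group_compact_coarse_def by blast
  have un: "E \<union> F \<in> ?E" if "E \<in> ?E" "F \<in> ?E" for E F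
  proof -
    obtain K L where "compactin T K" "E \<subseteq> ?O K" "compactin T L" "F \<subseteq> ?O L"
      using memE[OF \<open>E \<in> ?E\<close>] memE[OF \<open>F \<in> ?E\<close>] by blast
    moreover have "?O K \<subseteq> ?O (K \<union> L)" "?O L \<subseteq> ?O (K \<union> L)"
      by blast+
    ultimately show ?thesis
      by (intro memI[of "K \<union> L"] compactin_Un Un_least) (assumption | rule subset_trans)+
  qed
  have conv: "E\<inverse> \<in> ?E" if "E \<in> ?E" for E
  proof -
    obtain K where "compactin T K" "E \<subseteq> ?O K"
      using memE[OF \<open>E \<in> ?E\<close>] by blast
    then show ?thesis
      by (intro memI[of K]) blast+
  qed
  have comp: "E O F \<in> ?E" if "E \<in> ?E" "F \<in> ?E" for E F
  proof -
    obtain K L where K: "compactin T K" "E \<subseteq> ?O K" and L: "compactin T L" "F \<subseteq> ?O L"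
      using memE[OF \<open>E \<in> ?E\<close>] memE[OF \<open>F \<in> ?E\<close>] by blast
    let ?iL = "(\<lambda>x. inv x) ` L"
    let ?m = "\<lambda>(x, y). x \<otimes> y"
    let ?M = "?m ` (?m ` (K \<times> ?iL) \<times> L)"
    show ?thesis
    proof (rule memI)
      show "compactin T (K \<union> ?M)"
        using K L by (intro compactin_Un compactin_mult compactin_m_inv)
      show "E O F \<subseteq> ?O (K \<union> ?M)"
      proof
        fix p assume "p \<in> E O F"
        then obtain x y z where p: "p = (x, z)" "(x, y) \<in> E" "(y, z) \<in> F"
          by auto
        obtain g a b where 1: "x = g \<otimes> a" "y = g \<otimes> b" "g \<in> carrier G" "a \<in> K" "b \<in> K"
          using p K by blast
        obtain h c d where 2: "y = h \<otimes> c" "z = h \<otimes> d" "h \<in> carrier G" "c \<in> L" "d \<in> L"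
          using p L by blast
        have car: "b \<in> carrier G" "c \<in> carrier G" "d \<in> carrier G"
          using 1 2 K L compactin_carrier by blast+
        have "h = g \<otimes> b \<otimes> inv c"
          using 1 2 car by (metis inv_solve_right m_closed)
        then have "z = g \<otimes> (b \<otimes> inv c \<otimes> d)"
          using 1 2 car by (simp add: m_assoc)
        moreover have "b \<otimes> inv c \<otimes> d \<in> ?M"
          using 1 2 by force
        ultimately show "p \<in> ?O (K \<union> ?M)"
          using p 1 by blast
      qed
    qed
  qed
  show ?thesis
    unfolding coarse_structure_def
    by (intro conjI ballI allI impI subsetI PowI)
      (rule subsetD[OF sub] diag down un conv comp; assumption)+
qed

lemma subgroup_closure_of:
  assumes "subgroup H G"
  shows "subgroup (T closure_of H) G"
proof
  have H: "H \<subseteq> carrier G"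
    using assms by (simp add: subgroup.subset)
  show "T closure_of H \<subseteq> carrier G"
    using closure_of_subset_topspace topspace_eq by fastforce
  show "\<one> \<in> T closure_of H"
    using closure_of_subset[of H T] H topspace_eq subgroup.one_closed[OF assms] by auto
  show "x \<otimes> y \<in> T closure_of H" if "x \<in> T closure_of H" "y \<in> T closure_of H" for x y
  proof -
    have "(\<lambda>(x, y). x \<otimes> y) ` (H \<times> H) \<subseteq> H"
      using subgroup.m_closed[OF assms] by auto
    then have "T closure_of (\<lambda>(x, y). x \<otimes> y) ` (H \<times> H) \<subseteq> T closure_of H"
      by (rule closure_of_mono)
    then have "(\<lambda>(x, y). x \<otimes> y) ` ((T closure_of H) \<times> (T closure_of H)) \<subseteq> T closure_of H"
      using continuous_map_image_closure_subset[OF continuous_mult, of "H \<times> H"]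
      unfolding closure_of_Times by (rule subset_trans[rotated])
    with that show ?thesis
      by auto
  qed
  show "inv x \<in> T closure_of H" if "x \<in> T closure_of H" for x
  proof -
    have "(\<lambda>x. inv x) ` H \<subseteq> H"
      using subgroup.m_inv_closed[OF assms] by auto
    then show ?thesis
      using continuous_map_image_closure_subset[OF continuous_inv, of H]
        closure_of_mono[of _ H T] that by blast
  qed
qed

lemma subgroup_hausdorff_topological_group:
  assumes "subgroup H G"
  shows "hausdorff_topological_group (G\<lparr>carrier := H\<rparr>) (subtopology T H)"
proof -
  have H: "H \<subseteq> carrier G"
    using assms by (simp add: subgroup.subset)
  interpret S: group "G\<lparr>carrier := H\<rparr>"
    using assms by (rule subgroup_imp_group)
  show ?thesis
  proof
    show "topspace (subtopology T H) = carrier (G\<lparr>carrier := H\<rparr>)"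
      using H by (auto simp: topspace_eq)
    show "Hausdorff_space (subtopology T H)"
      using Hausdorff by (rule Hausdorff_space_subtopology)
    have "continuous_map (subtopology (prod_topology T T) (H \<times> H)) (subtopology T H) (\<lambda>(x, y). x \<otimes> y)"
      using continuous_mult subgroup.m_closed[OF assms]
      by (intro continuous_map_into_subtopology continuous_map_from_subtopology) auto
    then show "continuous_map (prod_topology (subtopology T H) (subtopology T H)) (subtopology T H)
        (\<lambda>(x, y). x \<otimes>\<^bsub>G\<lparr>carrier := H\<rparr>\<^esub> y)"
      by (simp add: subtopology_Times)
    have "continuous_map (subtopology T H) (subtopology T H) (\<lambda>x. inv x)"
      using continuous_inv subgroup.m_inv_closed[OF assms]
      by (intro continuous_map_into_subtopology continuous_map_from_subtopology) auto
    then show "continuous_map (subtopology T H) (subtopology T H) (\<lambda>x. inv\<^bsub>G\<lparr>carrier := H\<rparr>\<^esub> x)"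
      by (rule continuous_map_eq) (simp add: m_inv_consistent[OF assms])
  qed
qed

end

end

theory Submission
  imports Defs
begin

text \<open>An entourage of a closed subgroup is an entourage of the group, and a compact set meets a
  closed subgroup in a compact set, so covers of the group restrict to closed subgroups. Conversely,
  an entourage controlled by a compact \<open>K\<close> only relates points in the same left coset of any
  subgroup \<open>H\<close> containing \<open>K\<close>; hence a cover of \<open>H\<close> can be translated to all left cosets
  without losing disjointness.\<close>

context hausdorff_topological_group
begin

section \<open>Restriction of entourages and covers to closed subgroups\<close>

lemma subtopology_entourage:
  assumes "subgroup H G" and "L \<in> group_compact_coarse (G\<lparr>carrier := H\<rparr>) (subtopology T H)"
  shows "L \<in> group_compact_coarse G T"
proof -
  obtain K where K: "compactin (subtopology T H) K"
      "L \<subseteq> {(g \<otimes> a, g \<otimes> b) | g a b. g \<in> H \<and> a \<in> K \<and> b \<in> K}"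
    using assms(2) unfolding group_compact_coarse_def by auto
  then have "L \<subseteq> {(g \<otimes> a, g \<otimes> b) | g a b. g \<in> carrier G \<and> a \<in> K \<and> b \<in> K}"
    using subgroup.subset[OF assms(1)] by blast
  with K(1) show ?thesis
    unfolding group_compact_coarse_def compactin_subtopology by blast
qed

text \<open>In a pair \<open>(g \<otimes> a, g \<otimes> b)\<close> with both entries in
  \<open>H\<close>, the factor \<open>g\<close> may lie outside \<open>H\<close>. The pair is
  therefore rebased at its own first entry \<open>x\<close>, as
  \<open>(x \<otimes> \<one>, x \<otimes> (inv x \<otimes> y))\<close>. Since
  \<open>inv x \<otimes> y = inv a \<otimes> b\<close>, the second factor stays in the trace on
  \<open>H\<close> of a compact set, and this trace is compact because \<open>H\<close> is
  closed.\<close>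

lemma closed_subgroup_entourage:
  assumes H: "subgroup H G" and closed: "closedin T H" and M: "M \<in> group_compact_coarse G T"
  shows "M \<inter> H \<times> H \<in> group_compact_coarse (G\<lparr>carrier := H\<rparr>) (subtopology T H)"
proof -
  obtain K where K: "compactin T K"
      "M \<subseteq> {(g \<otimes> a, g \<otimes> b) | g a b. g \<in> carrier G \<and> a \<in> K \<and> b \<in> K}"
    using M unfolding group_compact_coarse_def by auto
  let ?Q = "(\<lambda>(x, y). x \<otimes> y) ` ((\<lambda>x. inv x) ` K \<times> K)"
  let ?K = "{\<one>} \<union> (H \<inter> ?Q)"
  have "compactin T ?K"
    using K(1) closed
    by (intro compactin_Un closed_Int_compactin compactin_mult compactin_m_inv)
      (simp_all add: topspace_eq)
  then have "compactin (subtopology T H) ?K"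
    using subgroup.one_closed[OF H] by (simp add: compactin_subtopology)
  moreover have "M \<inter> H \<times> H \<subseteq> {(g \<otimes> a, g \<otimes> b) | g a b. g \<in> H \<and> a \<in> ?K \<and> b \<in> ?K}"
  proof
    fix p assume p: "p \<in> M \<inter> H \<times> H"
    then obtain x y where xy: "p = (x, y)" "x \<in> H" "y \<in> H"
      by blast
    with p K(2) obtain g a b where
      g: "x = g \<otimes> a" "y = g \<otimes> b" "g \<in> carrier G" "a \<in> K" "b \<in> K"
      by blast
    have car: "a \<in> carrier G" "b \<in> carrier G" "x \<in> carrier G" "y \<in> carrier G"
      using g xy compactin_carrier[OF K(1)] subgroup.subset[OF H] by blast+
    have "inv x \<otimes> y = inv a \<otimes> b"
      using g car by (simp add: inv_mult_group m_assoc inv_solve_left')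
    then have "inv x \<otimes> y \<in> ?Q"
      using g by force
    moreover have "inv x \<otimes> y \<in> H"
      using xy H by (simp add: subgroup.m_closed subgroup.m_inv_closed)
    moreover have "x = x \<otimes> \<one>" "y = x \<otimes> (inv x \<otimes> y)"
      using car by (simp_all add: m_assoc[symmetric])
    ultimately show "p \<in> {(g \<otimes> a, g \<otimes> b) | g a b. g \<in> H \<and> a \<in> ?K \<and> b \<in> ?K}"
      using xy by blast
  qed
  ultimately show ?thesis
    unfolding group_compact_coarse_def mem_Collect_eq by (intro exI[of _ ?K]) simp
qed

lemma asdim_group_closed_subgroup_le:
  assumes H: "subgroup H G" and closed: "closedin T H"
  shows "asdim_group (G\<lparr>carrier := H\<rparr>) (subtopology T H) \<le> asdim_group G T"
proof (cases "asdim_group G T")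
  case (enat n)
  let ?EH = "group_compact_coarse (G\<lparr>carrier := H\<rparr>) (subtopology T H)"
  have G: "asdim_le (carrier G) (group_compact_coarse G T) n"
    using enat by (simp add: asdim_group_def flip: asdim_le_enat_iff)
  have "asdim_le H ?EH n"
    unfolding asdim_le_def
  proof
    fix L assume "L \<in> ?EH"
    then have L: "L \<in> group_compact_coarse G T"
      by (rule subtopology_entourage[OF H])
    obtain \<U> :: "nat \<Rightarrow> 'a set set" where
      U: "\<Union> (\<Union>i\<le>n. \<U> i) = carrier G" "\<forall>i\<le>n. entourage_disjoint L (\<U> i)"
        "uniformly_bounded (group_compact_coarse G T) (\<Union>i\<le>n. \<U> i)"
      using bspec[OF G[unfolded asdim_le_def] L] by (elim exE conjE)
    obtain M where M: "M \<in> group_compact_coarse G T" "\<forall>A\<in>(\<Union>i\<le>n. \<U> i). A \<times> A \<subseteq> M"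
      using U(3) unfolding uniformly_bounded_def by blast
    define \<V> where "\<V> i = (\<lambda>A. A \<inter> H) ` \<U> i" for i
    have "\<Union> (\<Union>i\<le>n. \<V> i) = \<Union> (\<Union>i\<le>n. \<U> i) \<inter> H"
      by (auto simp: \<V>_def)
    also have "\<dots> = H"
      using U(1) subgroup.subset[OF H] by blast
    finally have "\<Union> (\<Union>i\<le>n. \<V> i) = H" .
    \<comment> \<open>Distinct traces on \<open>H\<close> come from distinct members of
      \<open>\<U> i\<close>, and shrinking sets preserves disjointness.\<close>
    moreover have "\<forall>i\<le>n. entourage_disjoint L (\<V> i)"
      using U(2) by (fastforce simp: entourage_disjoint_def \<V>_def)
    moreover have "\<forall>A\<in>(\<Union>i\<le>n. \<V> i). A \<times> A \<subseteq> M \<inter> H \<times> H"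
      using M(2) by (fastforce simp: \<V>_def)
    then have "uniformly_bounded ?EH (\<Union>i\<le>n. \<V> i)"
      unfolding uniformly_bounded_def
      using closed_subgroup_entourage[OF H closed M(1)] by blast
    ultimately show "\<exists>\<U>. \<Union> (\<Union>i\<le>n. \<U> i) = H \<and> (\<forall>i\<le>n. entourage_disjoint L (\<U> i)) \<and>
        uniformly_bounded ?EH (\<Union>i\<le>n. \<U> i)"
      by blast
  qed
  then show ?thesis
    by (simp add: asdim_group_def asdim_le_enat_iff enat[unfolded asdim_group_def])
qed simp

section \<open>Transversals of left cosets and extension of covers from a subgroup\<close>

lemma left_coset_representatives:
  assumes H: "subgroup H G"
  obtains R where "R \<subseteq> carrier G"
    and "\<And>x. x \<in> carrier G \<Longrightarrow> \<exists>r\<in>R. inv r \<otimes> x \<in> H"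
    and "\<And>r s. r \<in> R \<Longrightarrow> s \<in> R \<Longrightarrow> inv r \<otimes> s \<in> H \<Longrightarrow> r = s"
proof -
  \<comment> \<open>Picks an element of the left coset of \<open>x\<close>; the transversal will be
    the range of \<open>rep\<close>.\<close>
  define rep where "rep x = (SOME y. y \<in> carrier G \<and> inv x \<otimes> y \<in> H)" for x
  have rep: "rep x \<in> carrier G \<and> inv x \<otimes> rep x \<in> H" if "x \<in> carrier G" for x
    unfolding rep_def
    by (rule someI[of _ x]) (use that H in \<open>simp add: subgroup.one_closed\<close>)
  have sym: "inv y \<otimes> x \<in> H" if "x \<in> carrier G" "y \<in> carrier G" "inv x \<otimes> y \<in> H" for x y
    using subgroup.m_inv_closed[OF H that(3)] that by (simp add: inv_mult_group)
  have trans: "inv x \<otimes> z \<in> H"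
    if "x \<in> carrier G" "y \<in> carrier G" "z \<in> carrier G" "inv x \<otimes> y \<in> H" "inv y \<otimes> z \<in> H" for x y z
  proof -
    have "(inv x \<otimes> y) \<otimes> (inv y \<otimes> z) = inv x \<otimes> z"
      using that by (simp add: m_assoc[symmetric]) (simp add: m_assoc)
    with subgroup.m_closed[OF H that(4,5)] show ?thesis
      by simp
  qed
  have same: "rep x = rep y" if "x \<in> carrier G" "y \<in> carrier G" "inv x \<otimes> y \<in> H" for x y
  proof -
    \<comment> \<open>Two points of one coset define the same predicate, so the choice operator
      returns the same element for both.\<close>
    have "(\<lambda>z. z \<in> carrier G \<and> inv x \<otimes> z \<in> H) = (\<lambda>z. z \<in> carrier G \<and> inv y \<otimes> z \<in> H)"
      using that sym trans by blast
    then show ?thesis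
      unfolding rep_def by simp
  qed
  \<comment> \<open>As \<open>rep x\<close> lies in the coset of \<open>x\<close>, representatives
    are fixed by \<open>rep\<close>; hence two of them in one coset coincide.\<close>
  have idem: "rep r = r" if "r \<in> rep ` carrier G" for r
  proof -
    obtain x where x: "x \<in> carrier G" and r: "r = rep x"
      using \<open>r \<in> rep ` carrier G\<close> by blast
    have "rep x = rep (rep x)"
      using same[OF x] rep[OF x] by blast
    then show ?thesis
      unfolding r by (rule HOL.sym)
  qed
  show ?thesis
  proof (rule that)
    show "rep ` carrier G \<subseteq> carrier G"
      using rep by blast
    show "\<exists>r\<in>rep ` carrier G. inv r \<otimes> x \<in> H" if "x \<in> carrier G" for x
    proof (rule bexI)
      show "inv (rep x) \<otimes> x \<in> H"
        using rep[OF that] sym that by simp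
    qed (simp add: that)
    show "r = s" if "r \<in> rep ` carrier G" "s \<in> rep ` carrier G" "inv r \<otimes> s \<in> H" for r s
    proof -
      have "r \<in> carrier G" "s \<in> carrier G"
        using that(1,2) rep by blast+
      then have "rep r = rep s"
        using that(3) by (rule same)
      then show ?thesis
        unfolding idem[OF that(1)] idem[OF that(2)] .
    qed
  qed
qed

text \<open>The subgroup may vary with \<open>K\<close>, but \<open>n\<close> may not: each
  entourage of \<open>G\<close> is handled inside a single \<open>H\<close>. Sets of the form
  \<open>{(g \<otimes> a, g \<otimes> b)}\<close>, with \<open>g\<close> ranging over the whole
  group, are invariant under left translation, so one bound serves the translates to all
  cosets.\<close>

lemma asdim_le_of_subgroups:
  assumes sub: "\<And>K. compactin T K \<Longrightarrow> \<exists>H. subgroup H G \<and> K \<subseteq> H \<and>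
      asdim_le H (group_compact_coarse (G\<lparr>carrier := H\<rparr>) (subtopology T H)) n"
  shows "asdim_le (carrier G) (group_compact_coarse G T) n"
  unfolding asdim_le_def
proof
  fix L assume "L \<in> group_compact_coarse G T"
  then obtain K where K: "compactin T K"
      and L: "L \<subseteq> {(g \<otimes> a, g \<otimes> b) | g a b. g \<in> carrier G \<and> a \<in> K \<and> b \<in> K}"
    unfolding group_compact_coarse_def by auto
  let ?EH = "\<lambda>H. group_compact_coarse (G\<lparr>carrier := H\<rparr>) (subtopology T H)"
  obtain H where H: "subgroup H G" "K \<subseteq> H" "asdim_le H (?EH H) n"
    using sub[OF K] by blast
  have HG: "H \<subseteq> carrier G"
    using H(1) by (rule subgroup.subset)
  \<comment> \<open>The full entourage that \<open>K\<close> controls in \<open>H\<close>: it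
    contains every pair of \<open>L\<close> that joins two points of one coset, once that pair is
    translated back into \<open>H\<close>.\<close>
  define L' where "L' = {(g \<otimes> a, g \<otimes> b) | g a b. g \<in> H \<and> a \<in> K \<and> b \<in> K}"
  have "L' \<in> ?EH H"
    unfolding group_compact_coarse_def L'_def using K H(2) by (auto simp: compactin_subtopology)
  then obtain \<U> :: "nat \<Rightarrow> 'a set set" where
    U: "\<Union> (\<Union>i\<le>n. \<U> i) = H" "\<forall>i\<le>n. entourage_disjoint L' (\<U> i)"
      "uniformly_bounded (?EH H) (\<Union>i\<le>n. \<U> i)"
    using H(3) unfolding asdim_le_def by blast
  obtain M where M: "M \<in> ?EH H" "\<forall>A\<in>(\<Union>i\<le>n. \<U> i). A \<times> A \<subseteq> M"
    using U(3) unfolding uniformly_bounded_def by blast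
  obtain C where C: "compactin (subtopology T H) C"
      "M \<subseteq> {(g \<otimes> a, g \<otimes> b) | g a b. g \<in> H \<and> a \<in> C \<and> b \<in> C}"
    using M(1) unfolding group_compact_coarse_def by auto
  obtain R where R: "R \<subseteq> carrier G" "\<And>x. x \<in> carrier G \<Longrightarrow> \<exists>r\<in>R. inv r \<otimes> x \<in> H"
      "\<And>r s. r \<in> R \<Longrightarrow> s \<in> R \<Longrightarrow> inv r \<otimes> s \<in> H \<Longrightarrow> r = s"
    using left_coset_representatives[OF H(1)] by metis
  \<comment> \<open>All translates of \<open>\<U> i\<close> go into the same family, so the number
    of families remains \<open>n + 1\<close> however many cosets there are.\<close>
  define \<V> where "\<V> i = {(\<lambda>a. r \<otimes> a) ` A | r A. r \<in> R \<and> A \<in> \<U> i}" for i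
  have UH: "A \<subseteq> H" if "A \<in> \<U> i" "i \<le> n" for A i
    using U(1) that by blast
  have "\<Union> (\<Union>i\<le>n. \<V> i) = carrier G"
  proof
    show "\<Union> (\<Union>i\<le>n. \<V> i) \<subseteq> carrier G"
    proof
      fix x assume "x \<in> \<Union> (\<Union>i\<le>n. \<V> i)"
      then obtain i r A a where "i \<le> n" "r \<in> R" "A \<in> \<U> i" "a \<in> A" "x = r \<otimes> a"
        unfolding \<V>_def by blast
      moreover from this have "a \<in> carrier G" "r \<in> carrier G"
        using UH HG R(1) by blast+
      ultimately show "x \<in> carrier G"
        by simp
    qed
    show "carrier G \<subseteq> \<Union> (\<Union>i\<le>n. \<V> i)"
    proof
      fix x assume x: "x \<in> carrier G"
      then obtain r where r: "r \<in> R" "inv r \<otimes> x \<in> H"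
        using R(2) by blast
      then obtain i A where "i \<le> n" "A \<in> \<U> i" "inv r \<otimes> x \<in> A"
        using U(1) by blast
      moreover have "x = r \<otimes> (inv r \<otimes> x)"
        using x r R(1) by (simp add: m_assoc[symmetric] subset_iff)
      ultimately show "x \<in> \<Union> (\<Union>i\<le>n. \<V> i)"
        unfolding \<V>_def using r by blast
    qed
  qed
  moreover have "entourage_disjoint L (\<V> i)" if i: "i \<le> n" for i
    unfolding entourage_disjoint_def
  proof (intro ballI impI, rule ccontr)
    fix X Y assume XY: "X \<in> \<V> i" "Y \<in> \<V> i" "X \<noteq> Y" "X \<times> Y \<inter> L \<noteq> {}"
    obtain r A where r: "X = (\<lambda>a. r \<otimes> a) ` A" "r \<in> R" "A \<in> \<U> i"
      using XY(1) unfolding \<V>_def by blast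
    obtain s B where s: "Y = (\<lambda>a. s \<otimes> a) ` B" "s \<in> R" "B \<in> \<U> i"
      using XY(2) unfolding \<V>_def by blast
    obtain a b where ab: "a \<in> A" "b \<in> B" "(r \<otimes> a, s \<otimes> b) \<in> L"
      using XY(4) r(1) s(1) by blast
    then obtain g k l where g: "r \<otimes> a = g \<otimes> k" "s \<otimes> b = g \<otimes> l" "g \<in> carrier G" "k \<in> K" "l \<in> K"
      using L by blast
    have inH: "a \<in> H" "b \<in> H" "k \<in> H" "l \<in> H"
      using ab g UH[OF r(3) i] UH[OF s(3) i] H(2) by blast+
    then have car: "a \<in> carrier G" "b \<in> carrier G" "k \<in> carrier G" "l \<in> carrier G"
        "r \<in> carrier G" "s \<in> carrier G"
      using HG R(1) r(2) s(2) by blast+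
    \<comment> \<open>First \<open>g\<close> is shown to lie in the coset of \<open>r\<close>, and
      then \<open>s\<close> in that of \<open>g\<close>, because \<open>a\<close>, \<open>b\<close>,
      \<open>k\<close>, \<open>l\<close> all belong to \<open>H\<close>. So a pair in
      \<open>L\<close> forces \<open>r = s\<close>.\<close>
    have rg: "inv r \<otimes> g = a \<otimes> inv k"
    proof -
      have "g = r \<otimes> a \<otimes> inv k"
        using g car by (metis inv_solve_right m_closed)
      then show ?thesis
        using car by (simp add: m_assoc inv_solve_left')
    qed
    have sg: "s = g \<otimes> l \<otimes> inv b"
      using g car by (metis inv_solve_right m_closed)
    have rgH: "inv r \<otimes> g \<in> H"
      unfolding rg using inH H(1) by (simp add: subgroup.m_closed subgroup.m_inv_closed)
    have "inv r \<otimes> s = (inv r \<otimes> g) \<otimes> (l \<otimes> inv b)"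
      unfolding sg using car g(3) by (simp add: m_assoc)
    then have "inv r \<otimes> s \<in> H"
      using rgH inH H(1) by (simp add: subgroup.m_closed subgroup.m_inv_closed)
    then have rs: "r = s"
      using R(3) r(2) s(2) by blast
    \<comment> \<open>Cancelling the common translation \<open>r\<close> leaves a pair based at
      \<open>inv r \<otimes> g\<close>, which lies in \<open>H\<close>.\<close>
    have "a = inv r \<otimes> g \<otimes> k" "b = inv r \<otimes> g \<otimes> l"
      using g car rs by (simp_all add: m_assoc inv_solve_left)
    then have "(a, b) \<in> L'"
      unfolding L'_def using rgH g by blast
    \<comment> \<open>With \<open>r = s\<close>, equal sets would have equal translates, contrary to
      \<open>X \<noteq> Y\<close>.\<close>
    moreover have "A \<noteq> B"
      using XY(3) r(1) s(1) rs by blast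
    ultimately show False
      using U(2) i r(3) s(3) ab unfolding entourage_disjoint_def by blast
  qed
  moreover have "uniformly_bounded (group_compact_coarse G T) (\<Union>i\<le>n. \<V> i)"
    unfolding uniformly_bounded_def
  proof (intro bexI ballI)
    \<comment> \<open>The compact set \<open>C\<close> from \<open>H\<close> is kept; the
      translation by \<open>r\<close> is absorbed into the free factor \<open>g\<close>.\<close>
    let ?N = "{(g \<otimes> a, g \<otimes> b) | g a b. g \<in> carrier G \<and> a \<in> C \<and> b \<in> C}"
    show "?N \<in> group_compact_coarse G T"
      using C(1) unfolding group_compact_coarse_def compactin_subtopology by blast
    fix X assume "X \<in> (\<Union>i\<le>n. \<V> i)"
    then obtain i r A where A: "i \<le> n" "r \<in> R" "A \<in> \<U> i" "X = (\<lambda>a. r \<otimes> a) ` A"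
      unfolding \<V>_def by blast
    show "X \<times> X \<subseteq> ?N"
    proof
      fix p assume "p \<in> X \<times> X"
      then obtain a b where ab: "p = (r \<otimes> a, r \<otimes> b)" "a \<in> A" "b \<in> A"
        using A(4) by blast
      then have "(a, b) \<in> M"
        using M(2) A by blast
      then obtain h c d where h: "a = h \<otimes> c" "b = h \<otimes> d" "h \<in> H" "c \<in> C" "d \<in> C"
        using C(2) by blast
      moreover have car: "r \<in> carrier G" "h \<in> carrier G" "c \<in> carrier G" "d \<in> carrier G"
        using h HG R(1) A(2) C(1) by (auto simp: compactin_subtopology)
      ultimately have "p = (r \<otimes> h \<otimes> c, r \<otimes> h \<otimes> d)" "r \<otimes> h \<in> carrier G"
        using ab by (simp_all add: m_assoc)
      then show "p \<in> ?N"
        using h by blast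
    qed
  qed
  ultimately show "\<exists>\<U>. \<Union> (\<Union>i\<le>n. \<U> i) = carrier G \<and>
      (\<forall>i\<le>n. entourage_disjoint L (\<U> i)) \<and>
      uniformly_bounded (group_compact_coarse G T) (\<Union>i\<le>n. \<U> i)"
    by blast
qed

end

section \<open>The supremum formula\<close>

theorem corollary3p14:
  fixes G :: "('a, 'b) monoid_scheme" and T :: "'a topology"
  assumes "hausdorff_topological_group G T"
  shows "asdim_group G T =
    (SUP K\<in>{K. compactin T K}.
       asdim_group (G\<lparr>carrier := T closure_of (generate G K)\<rparr>)
                   (subtopology T (T closure_of (generate G K))))"
    (is "_ = ?S")
proof (rule antisym)
  interpret hausdorff_topological_group G T
    by (rule assms)
  let ?H = "\<lambda>K. T closure_of (generate G K)"
  have H: "subgroup (?H K) G" if "compactin T K" for K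
    using that by (intro subgroup_closure_of generate_is_subgroup compactin_carrier)
  show "?S \<le> asdim_group G T"
    by (rule SUP_least) (simp add: H asdim_group_closed_subgroup_le)
  show "asdim_group G T \<le> ?S"
  \<comment> \<open>A finite supremum \<open>n\<close> bounds the dimension for every compact
    \<open>K\<close> at once, which supplies the uniform \<open>n\<close> of
    \<open>asdim_le_of_subgroups\<close>. An infinite supremum bounds anything.\<close>
  proof (cases ?S)
    case (enat n)
    have "asdim_le (carrier G) (group_compact_coarse G T) n"
    proof (rule asdim_le_of_subgroups)
      fix K assume K: "compactin T K"
      have "asdim_group (G\<lparr>carrier := ?H K\<rparr>) (subtopology T (?H K)) \<le> ?S"
        by (rule SUP_upper) (simp add: K)
      then have "asdim_le (?H K)
          (group_compact_coarse (G\<lparr>carrier := ?H K\<rparr>) (subtopology T (?H K))) n"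
        unfolding enat by (simp add: asdim_group_def asdim_le_enat_iff)
      moreover have "generate G K \<subseteq> ?H K"
        using K generate_incl[OF compactin_carrier]
        by (intro closure_of_subset) (simp add: topspace_eq)
      then have "K \<subseteq> ?H K"
        by (meson generate.incl subset_iff)
      ultimately show "\<exists>H. subgroup H G \<and> K \<subseteq> H \<and>
          asdim_le H (group_compact_coarse (G\<lparr>carrier := H\<rparr>) (subtopology T H)) n"
        using H[OF K] by blast
    qed
    then show ?thesis
      unfolding enat by (simp add: asdim_group_def asdim_le_enat_iff)
  qed simp
qed

end
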